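(* For all $x\in(0,1)$, $$\alpha\, x\,\Phi(x^4,3/2,1/4) < \operatorname{arcsl}(x) < \beta\, x\,\Phi(x^4,3/2,1/4),$$ with the best possible constant factors $$\alpha=\frac18 \quad\text{and}\quad \beta=\frac{\operatorname{arcsl}(1)}{\Phi(1,3/2,1/4)}=0.12836\ldots.$$ Here "best possible" means that $\alpha=1/8$ is the largest real constant for which the left-hand inequality holds for all $x\in(0,1)$, and $\beta=\operatorname{arcsl}(1)/\Phi(1,3/2,1/4)$ is the smallest real constant for which the right-hand inequality holds for all $x\in(0,1)$.
   Context: The arc lemniscate sine function is defined by $$\operatorname{arcsl}(x)=\int_0^x \frac{1}{\sqrt{1-t^4}}\,dt \qquad (-1\le x\le 1),$$ where for $x=\pm1$ the integral is a (convergent) improper integral. The Lerch zeta function is $$\Phi(z,s,a)=\sum_{k=0}^\infty \frac{z^k}{(k+a)^s},$$ used here with $s=3/2$, $a=1/4$ and real $z\in[0,1]$, where the series converges (with the convention $z^0=1$). The notation $0.12836\ldots$ denotes the beginning of the decimal expansion of $\beta$. *)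

theory Defs
  imports "HOL-Analysis.Analysis"
begin

(* The interval integral is oriented, so negative x is covered.  It is a Lebesgue integral over
   the open interval between the endpoints; as the integrand is positive there, it agrees at
   x = 1 and x = -1 with the improper integral.  Only -1 <= x <= 1 is meaningful. *)
definition arcsl :: "real \<Rightarrow> real" where
  "arcsl x = (LBINT t=ereal 0..ereal x. 1 / sqrt (1 - t ^ 4))"

(* Meaningful only where the series converges; the k = 0 term uses 0 ^ 0 = 1. *)
definition lerch_phi :: "real \<Rightarrow> real \<Rightarrow> real \<Rightarrow> real" where
  "lerch_phi z s a = (\<Sum>k. z ^ k / (real k + a) powr s)"

end

theory Submission
  imports Defs "HOL-Real_Asymp.Real_Asymp"
begin

text \<open>Expanding the integrand of \<open>arcsl\<close> in the binomial series and integrating termwise gives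
\<open>arcsl x = x * A (x ^ 4)\<close> on \<open>[0, 1]\<close>, where \<open>A\<close> is the power series with the coefficients
\<open>a k = (2k choose k) / (4 ^ k * (4k + 1))\<close> (\<open>arcsl_eq_series\<close>). The Lerch function
\<open>B z = lerch_phi z (3/2) (1/4)\<close> is the power series with the coefficients
\<open>b k = (k + 1/4) powr (-3/2)\<close>. Both coefficient sequences are positive and summable, and their
ratio \<open>a k / b k\<close> strictly increases from \<open>1/8\<close> (\<open>coeff_ratio_strict_mono\<close>).

Increasing coefficient ratios confine \<open>A z / B z\<close> strictly between its values at the endpoints:
above \<open>a 0 / b 0 = 1/8\<close> (\<open>power_series_gt_first_ratio\<close>) and below \<open>A 1 / B 1\<close>
(\<open>power_series_lt_endpoint_ratio\<close>). By the Weierstrass test both series are continuous on the closed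
interval \<open>[0, 1]\<close> (\<open>continuous_on_power_series_closed\<close>), so the two values are limits of the quotient
and no better constants are possible.

For the decimal expansion, \<open>A 1\<close> and \<open>B 1\<close> are enclosed by summing 16 terms and bounding the tail
by a telescoping series (\<open>arcsl_coeff_sum_bounds\<close>, \<open>lerch_coeff_sum_bounds\<close>). The tail of \<open>A 1\<close> is
a coefficient times a nearly constant rational function; the tail of \<open>B 1\<close> is compared with an
integral by the midpoint and trapezoidal rules.\<close>

section \<open>Telescoping tails and comparison of power series\<close>

text \<open>Together with its counterpart below, this turns a numerical estimate of an infinite sum into a
finite computation: it suffices to guess \<open>G\<close> close to the tail of the series and to check one
inequality between consecutive values of \<open>G\<close>.\<close>

lemma suminf_le_telescoping_tail:
  fixes f G :: "nat \<Rightarrow> real"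
  assumes f: "summable f" and G: "G \<longlonglongrightarrow> 0"
    and step: "\<And>k. N \<le> k \<Longrightarrow> f k \<le> G k - G (Suc k)"
  shows "suminf f \<le> (\<Sum>k<N. f k) + G N"
proof -
  have "(\<lambda>k. G (k + N)) \<longlonglongrightarrow> 0" by (rule LIMSEQ_ignore_initial_segment[OF G])
  from telescope_sums'[OF this]
  have tel: "(\<lambda>k. G (k + N) - G (Suc k + N)) sums G N" by simp
  have "(\<Sum>k. f (k + N)) \<le> G N"
    by (rule sums_le[OF _ summable_sums tel])
       (use step f in \<open>auto simp: summable_iff_shift\<close>)
  then show ?thesis using suminf_split_initial_segment[OF f, of N] by simp
qed

lemma suminf_ge_telescoping_tail:
  fixes f G :: "nat \<Rightarrow> real"
  assumes f: "summable f" and G: "G \<longlonglongrightarrow> 0"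
    and step: "\<And>k. N \<le> k \<Longrightarrow> G k - G (Suc k) \<le> f k"
  shows "(\<Sum>k<N. f k) + G N \<le> suminf f"
proof -
  have "suminf (\<lambda>k. - f k) \<le> (\<Sum>k<N. - f k) + (- G N)"
    by (rule suminf_le_telescoping_tail)
       (use f tendsto_minus[OF G] step in \<open>auto intro: summable_minus simp: algebra_simps\<close>)
  then show ?thesis using f by (simp add: suminf_minus sum_negf)
qed

lemma summable_power_term:
  fixes f :: "nat \<Rightarrow> real"
  assumes "summable f" "\<And>k. 0 \<le> f k" "0 \<le> z" "z \<le> 1"
  shows "summable (\<lambda>k. f k * z ^ k)"
proof (rule summable_comparison_test'[OF assms(1)])
  fix n :: nat
  have "f n * z ^ n \<le> f n * 1"
    using assms by (intro mult_left_mono power_le_one) auto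
  then show "norm (f n * z ^ n) \<le> f n" using assms by simp
qed

lemma continuous_on_power_series_closed:
  fixes f :: "nat \<Rightarrow> real"
  assumes "summable f" "\<And>k. 0 \<le> f k"
  shows "continuous_on {0..1} (\<lambda>z. \<Sum>k. f k * z ^ k)"
proof (rule uniform_limit_theorem)
  show "uniform_limit {0..1} (\<lambda>n z. \<Sum>k<n. f k * z ^ k) (\<lambda>z. \<Sum>k. f k * z ^ k) sequentially"
  proof (rule Weierstrass_m_test)
    fix n and z :: real assume z: "z \<in> {0..1}"
    have "f n * z ^ n \<le> f n * 1"
      using assms z by (intro mult_left_mono power_le_one) auto
    then show "norm (f n * z ^ n) \<le> f n" using assms z by simp
  qed (rule assms)
qed (auto intro!: always_eventually continuous_intros)

text \<open>The difference of the two sides is a power series whose constant term vanishes and whose other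
coefficients are positive, because every later ratio exceeds the first one.\<close>

lemma power_series_gt_first_ratio:
  fixes a b :: "nat \<Rightarrow> real"
  assumes sa: "summable a" and sb: "summable b" and a: "\<And>k. 0 \<le> a k" and b: "\<And>k. 0 < b k"
    and mono: "strict_mono (\<lambda>k. a k / b k)" and z: "0 < z" "z \<le> 1"
  shows "a 0 / b 0 * (\<Sum>k. b k * z ^ k) < (\<Sum>k. a k * z ^ k)"
proof -
  define r where "r = a 0 / b 0"
  note sz = summable_power_term[OF sa a, of z] summable_power_term[OF sb less_imp_le[OF b], of z]
  have gap: "r * b k < a k" if "0 < k" for k
    using strict_monoD[OF mono that] b[of k] by (simp add: r_def field_simps)
  have gap0: "r * b 0 = a 0" using b[of 0] by (simp add: r_def)
  have gap': "r * b k \<le> a k" for k using gap[of k] gap0 by (cases "k = 0") auto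
  have "0 < (\<Sum>k. (a k - r * b k) * z ^ k)"
  proof (rule suminf_pos2[where i = 1])
    have "summable (\<lambda>k. a k * z ^ k - r * (b k * z ^ k))"
      using sz z by (intro summable_diff summable_mult) auto
    then show "summable (\<lambda>k. (a k - r * b k) * z ^ k)" by (simp add: algebra_simps)
  qed (use gap[of 1] gap' z in auto)
  also have "\<dots> = (\<Sum>k. a k * z ^ k - r * (b k * z ^ k))" by (simp add: algebra_simps)
  also have "\<dots> = (\<Sum>k. a k * z ^ k) - r * (\<Sum>k. b k * z ^ k)"
    using sz z by (subst suminf_diff[symmetric]) (auto intro: summable_mult simp: suminf_mult)
  finally show ?thesis by (simp add: r_def)
qed

text \<open>The coefficients \<open>d k\<close> of the difference of the two sides have sum \<open>0\<close> and, as the ratios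
increase, change sign exactly once, from positive to nonpositive, at some index \<open>N\<close>. Subtracting
\<open>z ^ N\<close> times the vanishing sum replaces \<open>z ^ k\<close> by \<open>z ^ k - z ^ N\<close>, which changes sign at the
same index. So every term of the new series is nonnegative.\<close>

lemma power_series_lt_endpoint_ratio:
  fixes a b :: "nat \<Rightarrow> real"
  assumes sa: "summable a" and sb: "summable b" and a: "\<And>k. 0 \<le> a k" and b: "\<And>k. 0 < b k"
    and mono: "strict_mono (\<lambda>k. a k / b k)" and z: "0 \<le> z" "z < 1"
  shows "(\<Sum>k. a k * z ^ k) < suminf a / suminf b * (\<Sum>k. b k * z ^ k)"
proof -
  define r where "r = suminf a / suminf b"
  define d where "d k = r * b k - a k" for k
  note sz = summable_power_term[OF sa a, of z] summable_power_term[OF sb less_imp_le[OF b], of z]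
  have B: "0 < suminf b" using suminf_pos[OF sb] b by blast
  have sd: "summable d" unfolding d_def using sa sb by (intro summable_diff summable_mult)
  have d0: "suminf d = 0"
  proof -
    have "suminf d = r * suminf b - suminf a"
      unfolding d_def using sa sb
      by (subst suminf_diff[symmetric]) (auto intro: summable_mult simp: suminf_mult)
    then show ?thesis using B by (simp add: r_def)
  qed
  have dpos: "0 < d k \<longleftrightarrow> a k / b k < r" for k using b[of k] by (simp add: d_def field_simps)
  have dneg: "d k \<le> 0 \<longleftrightarrow> r \<le> a k / b k" for k using b[of k] by (simp add: d_def field_simps)
  have inc: "a j / b j \<le> a k / b k" if "j \<le> k" for j k
    using strict_mono_less_eq[OF mono] that by simp
  have "\<exists>k. d k \<le> 0" using suminf_pos[OF sd] d0 by (metis less_irrefl not_le)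
  define N where "N = (LEAST k. d k \<le> 0)"
  have N: "d N \<le> 0" unfolding N_def by (rule LeastI_ex) fact
  have lo: "0 < d k" if "k < N" for k using not_less_Least[of k "\<lambda>k. d k \<le> 0"] that by (auto simp: N_def)
  have hi: "d k \<le> 0" if "N \<le> k" for k using N inc[OF that] by (auto simp: dneg)
  have first: "0 < d 0"
  proof (rule ccontr)
    assume "\<not> 0 < d 0"
    then have "r \<le> a 0 / b 0" by (simp add: dpos)
    also have "\<dots> < a 1 / b 1" by (rule strict_monoD[OF mono]) simp
    finally have "d 1 < 0" using b[of 1] by (simp add: d_def field_simps)
    moreover have "d k \<le> 0" for k
      using \<open>r \<le> a 0 / b 0\<close> inc[of 0 k] by (auto simp: dneg)
    ultimately have "0 < (\<Sum>k. - d k)"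
      by (intro suminf_pos2[where i = 1]) (auto intro: summable_minus sd)
    then show False using d0 sd by (simp add: suminf_minus)
  qed
  have N0: "0 < N" using N first by (cases N) auto
  have s1: "summable (\<lambda>k. d k * z ^ k)"
  proof -
    have "summable (\<lambda>k. r * (b k * z ^ k) - a k * z ^ k)"
      using sz z by (intro summable_diff summable_mult) auto
    then show ?thesis by (simp add: d_def algebra_simps)
  qed
  have "0 < (\<Sum>k. d k * (z ^ k - z ^ N))"
  proof (rule suminf_pos2[where i = 0])
    show "summable (\<lambda>k. d k * (z ^ k - z ^ N))"
      using summable_diff[OF s1 summable_mult2[OF sd, of "z ^ N"]] by (simp add: algebra_simps)
    show "0 \<le> d k * (z ^ k - z ^ N)" for k
    proof (cases "k < N")
      case True
      then show ?thesis
        using lo[of k] z power_decreasing[of k N z] by simp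
    next
      case False
      then show ?thesis
        using hi[of k] z power_decreasing[of N k z] by (intro mult_nonpos_nonpos) auto
    qed
    show "0 < d 0 * (z ^ 0 - z ^ N)"
      using first z N0 by (simp add: power_less_one_iff)
  qed
  also have "\<dots> = (\<Sum>k. d k * z ^ k - d k * z ^ N)" by (simp add: algebra_simps)
  also have "\<dots> = (\<Sum>k. d k * z ^ k) - suminf d * z ^ N"
    using s1 sd by (subst suminf_diff[symmetric]) (auto intro: summable_mult2 simp: suminf_mult2)
  also have "\<dots> = (\<Sum>k. r * (b k * z ^ k) - a k * z ^ k)" by (simp add: d0 d_def algebra_simps)
  also have "\<dots> = r * (\<Sum>k. b k * z ^ k) - (\<Sum>k. a k * z ^ k)"
    using sz z by (subst suminf_diff[symmetric]) (auto intro: summable_mult simp: suminf_mult)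
  finally show ?thesis by (simp add: r_def)
qed

section \<open>Power series of the arc lemniscate sine and the Lerch function\<close>

text \<open>These are the numbers \<open>(2k choose k) / 4 ^ k\<close>. The Pochhammer form matches the binomial
series with exponent \<open>-1/2\<close>.\<close>

definition inv_sqrt_coeff :: "nat \<Rightarrow> real" where
  "inv_sqrt_coeff k = pochhammer (1/2) k / fact k"

lemma inv_sqrt_coeff_0: "inv_sqrt_coeff 0 = 1"
  by (simp add: inv_sqrt_coeff_def)

lemma inv_sqrt_coeff_Suc:
  "inv_sqrt_coeff (Suc k) = inv_sqrt_coeff k * ((2 * real k + 1) / (2 * real k + 2))"
  by (simp add: inv_sqrt_coeff_def pochhammer_Suc field_simps)

lemma inv_sqrt_coeff_pos: "0 < inv_sqrt_coeff k"
  by (simp add: inv_sqrt_coeff_def pochhammer_pos)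

lemma inv_sqrt_series:
  fixes u :: real
  assumes "\<bar>u\<bar> < 1"
  shows "(\<lambda>k. inv_sqrt_coeff k * u ^ k) sums (1 / sqrt (1 - u))"
proof -
  have "((- 1/2) gchoose k) * (- u) ^ k = inv_sqrt_coeff k * u ^ k" for k
  proof -
    have "(- 1) ^ k * (- u) ^ k = u ^ k" by (simp flip: power_mult_distrib)
    then show ?thesis
      by (simp add: gbinomial_pochhammer inv_sqrt_coeff_def mult.commute mult.left_commute)
  qed
  moreover have "(1 + - u) powr (- 1/2) = 1 / sqrt (1 - u)"
    using assms powr_minus_divide[of "1 - u" "1/2"] by (simp add: powr_half_sqrt)
  ultimately show ?thesis using gen_binomial_real[of "- u" "- 1/2"] assms by simp
qed

text \<open>The Wallis-type bound that gives both the decay of the coefficients and the summability of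
\<open>arcsl_coeff\<close>; it is invariant under the recursion because
\<open>(2k + 1)(2k + 3) \<le> (2k + 2)\<^sup>2\<close>.\<close>

lemma inv_sqrt_coeff_le: "inv_sqrt_coeff k ^ 2 * (2 * real k + 1) \<le> 1"
proof (induction k)
  case 0
  then show ?case by (simp add: inv_sqrt_coeff_0)
next
  case (Suc k)
  have "(2 * real k + 1) ^ 2 * (2 * real (Suc k) + 1) \<le> (2 * real k + 1) * (2 * real k + 2) ^ 2"
    by (simp add: algebra_simps power2_eq_square)
  then have "((2 * real k + 1) / (2 * real k + 2)) ^ 2 * (2 * real (Suc k) + 1) \<le> 2 * real k + 1"
    unfolding power_divide times_divide_eq_left by (subst pos_divide_le_eq) auto
  then have "inv_sqrt_coeff k ^ 2 * (((2 * real k + 1) / (2 * real k + 2)) ^ 2 * (2 * real (Suc k) + 1))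
      \<le> inv_sqrt_coeff k ^ 2 * (2 * real k + 1)"
    by (rule mult_left_mono) simp
  also have "\<dots> \<le> 1" by (rule Suc.IH)
  finally show ?case by (simp only: inv_sqrt_coeff_Suc power_mult_distrib mult.assoc)
qed

lemma inv_sqrt_coeff_tendsto_0: "inv_sqrt_coeff \<longlonglongrightarrow> 0"
proof (rule tendsto_sandwich[where f = "\<lambda>_. 0" and h = "\<lambda>k. 1 / sqrt (2 * real k + 1)"])
  show "(\<lambda>k. 1 / sqrt (2 * real k + 1)) \<longlonglongrightarrow> 0"
    by real_asymp
  have "inv_sqrt_coeff k \<le> 1 / sqrt (2 * real k + 1)" for k
  proof -
    have "inv_sqrt_coeff k * sqrt (2 * real k + 1) = sqrt (inv_sqrt_coeff k ^ 2 * (2 * real k + 1))"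
      using inv_sqrt_coeff_pos[of k] by (simp only: real_sqrt_mult real_sqrt_abs abs_of_pos)
    also have "\<dots> \<le> sqrt 1" by (rule real_sqrt_le_mono) (rule inv_sqrt_coeff_le)
    finally have "inv_sqrt_coeff k * sqrt (2 * real k + 1) \<le> 1" by simp
    then show ?thesis by (subst pos_le_divide_eq) (auto simp: add_nonneg_pos)
  qed
  then show "\<forall>\<^sub>F k in sequentially. inv_sqrt_coeff k \<le> 1 / sqrt (2 * real k + 1)" by simp
qed (simp_all add: less_imp_le[OF inv_sqrt_coeff_pos])

definition arcsl_coeff :: "nat \<Rightarrow> real" where
  "arcsl_coeff k = inv_sqrt_coeff k / (4 * real k + 1)"

definition lerch_coeff :: "nat \<Rightarrow> real" where
  "lerch_coeff k = 1 / (real k + 1/4) powr (3/2)"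

lemma arcsl_coeff_pos: "0 < arcsl_coeff k"
  by (simp add: arcsl_coeff_def inv_sqrt_coeff_pos add_nonneg_pos)

lemma lerch_coeff_pos: "0 < lerch_coeff k"
  by (simp add: lerch_coeff_def add_nonneg_pos)

lemma lerch_coeff_sqrt: "lerch_coeff k = 1 / ((real k + 1/4) * sqrt (real k + 1/4))"
proof -
  have "(real k + 1/4) powr (1 + 1/2) = (real k + 1/4) * sqrt (real k + 1/4)"
    by (subst powr_add) (auto simp: powr_half_sqrt)
  then show ?thesis by (simp add: lerch_coeff_def)
qed

lemma summable_lerch_coeff: "summable lerch_coeff"
proof (rule summable_comparison_test')
  show "summable (\<lambda>k. real k powr (- 3/2))" by (simp add: summable_real_powr_iff)
  show "norm (lerch_coeff k) \<le> real k powr (- 3/2)" if "1 \<le> k" for k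
  proof -
    have "lerch_coeff k = (real k + 1/4) powr (- 3/2)"
      using powr_minus_divide[of "real k + 1/4" "3/2"] by (simp add: lerch_coeff_def)
    also have "\<dots> \<le> real k powr (- 3/2)" using that by (intro powr_mono2') auto
    finally show ?thesis using lerch_coeff_pos[of k] by simp
  qed
qed

lemma coeff_ratio:
  "arcsl_coeff k / lerch_coeff k = inv_sqrt_coeff k * sqrt (real k + 1/4) / 4"
proof -
  define m where "m = real k + 1/4"
  have "4 * real k + 1 = 4 * m" "0 < m" by (auto simp: m_def)
  then show ?thesis
    unfolding arcsl_coeff_def lerch_coeff_sqrt m_def[symmetric] by simp
qed

text \<open>The central fact. After squaring, one step of the ratio increases because
\<open>(k + 5/4) (2k + 1)\<^sup>2\<close> exceeds \<open>(k + 1/4) (2k + 2)\<^sup>2\<close>; as polynomials in \<open>k\<close> the two differ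
only in the constant terms, \<open>5/4\<close> and \<open>1\<close>.\<close>

lemma coeff_ratio_strict_mono: "strict_mono (\<lambda>k. arcsl_coeff k / lerch_coeff k)"
proof (rule strict_monoI_Suc)
  fix k
  have "(real k + 1/4) * (2 * real k + 2) ^ 2 < (2 * real k + 1) ^ 2 * (real (Suc k) + 1/4)"
    by (simp add: power2_eq_square algebra_simps)
  then have "real k + 1/4 < ((2 * real k + 1) / (2 * real k + 2)) ^ 2 * (real (Suc k) + 1/4)"
    unfolding power_divide times_divide_eq_left by (subst pos_less_divide_eq) auto
  then have "sqrt (real k + 1/4) < sqrt (((2 * real k + 1) / (2 * real k + 2)) ^ 2 * (real (Suc k) + 1/4))"
    by (rule real_sqrt_less_mono)
  also have "\<dots> = (2 * real k + 1) / (2 * real k + 2) * sqrt (real (Suc k) + 1/4)"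
    by (subst real_sqrt_mult, subst real_sqrt_abs) simp
  finally have "inv_sqrt_coeff k * sqrt (real k + 1/4)
      < inv_sqrt_coeff k * ((2 * real k + 1) / (2 * real k + 2) * sqrt (real (Suc k) + 1/4))"
    by (rule mult_strict_left_mono) (rule inv_sqrt_coeff_pos)
  then show "arcsl_coeff k / lerch_coeff k < arcsl_coeff (Suc k) / lerch_coeff (Suc k)"
    unfolding coeff_ratio inv_sqrt_coeff_Suc by (simp only: mult.assoc divide_strict_right_mono zero_less_numeral)
qed

lemma summable_arcsl_coeff: "summable arcsl_coeff"
proof (rule summable_comparison_test'[OF summable_lerch_coeff])
  fix k
  have "inv_sqrt_coeff k ^ 2 * (real k + 1/4) \<le> inv_sqrt_coeff k ^ 2 * (2 * real k + 1)"
    by (intro mult_left_mono) auto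
  also note inv_sqrt_coeff_le
  finally have "sqrt (inv_sqrt_coeff k ^ 2 * (real k + 1/4)) \<le> sqrt 1" by (rule real_sqrt_le_mono)
  then have "inv_sqrt_coeff k * sqrt (real k + 1/4) \<le> 1"
    unfolding real_sqrt_mult real_sqrt_abs using inv_sqrt_coeff_pos[of k] by simp
  then have "arcsl_coeff k / lerch_coeff k \<le> 1" unfolding coeff_ratio by simp
  then show "norm (arcsl_coeff k) \<le> lerch_coeff k"
    using lerch_coeff_pos[of k] arcsl_coeff_pos[of k] by (simp add: field_simps)
qed

text \<open>Termwise integration of the binomial series. All terms are nonnegative and their integrals are
summable up to and including \<open>x = 1\<close>, so the improper case needs no separate limit: the series
fails to represent the integrand only at \<open>t = 1\<close>, a null set.\<close>

lemma arcsl_eq_series: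
  assumes x: "0 \<le> x" "x \<le> 1"
  shows "arcsl x = x * (\<Sum>k. arcsl_coeff k * (x ^ 4) ^ k)"
proof -
  define f where "f k t = inv_sqrt_coeff k * (t ^ (4 * k) * indicator {0..x} t)" for k t
  have f_nn: "0 \<le> f k t" for k t
    using inv_sqrt_coeff_pos[of k] by (auto simp: f_def indicator_def)
  have int: "integrable lborel (f k)" for k
  proof -
    have "set_integrable lborel {0..x} (\<lambda>t. t ^ (4 * k))"
      by (intro borel_integrable_atLeastAtMost' continuous_intros)
    then show ?thesis
      unfolding f_def set_integrable_def by (intro integrable_mult_right) (simp add: mult.commute)
  qed
  have val: "integral\<^sup>L lborel (f k) = x * (arcsl_coeff k * (x ^ 4) ^ k)" for k
    using integral_power[OF x(1), of "4 * k"]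
    unfolding f_def by (simp add: arcsl_coeff_def power_mult add.commute)
  have sums: "(\<lambda>k. f k t) sums (1 / sqrt (1 - t ^ 4) * indicator {0..x} t)" if "t \<noteq> 1" for t
  proof (cases "t \<in> {0..x}")
    case True
    then have "t ^ 4 < 1" using that x by (simp add: power_less_one_iff)
    then have "\<bar>t ^ 4\<bar> < 1" by simp
    from inv_sqrt_series[OF this] True show ?thesis by (simp add: f_def power_mult)
  qed (simp add: f_def)
  have ae: "AE t in lborel. t \<noteq> (1::real)" by (rule AE_lborel_singleton)
  have "(\<lambda>k. integral\<^sup>L lborel (f k)) sums (\<integral>t. (\<Sum>k. f k t) \<partial>lborel)"
  proof (rule sums_integral[OF int])
    show "AE t in lborel. summable (\<lambda>k. norm (f k t))"
      using ae by eventually_elim (use sums f_nn in \<open>auto simp: sums_iff\<close>)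
    show "summable (\<lambda>k. \<integral>t. norm (f k t) \<partial>lborel)"
      using x summable_power_term[OF summable_arcsl_coeff less_imp_le[OF arcsl_coeff_pos], of "x ^ 4"]
      by (simp add: f_nn val power_le_one summable_mult)
  qed
  moreover have "(\<integral>t. (\<Sum>k. f k t) \<partial>lborel) = (\<integral>t. 1 / sqrt (1 - t ^ 4) * indicator {0..x} t \<partial>lborel)"
  proof (rule integral_cong_AE)
    show "AE t in lborel. (\<Sum>k. f k t) = 1 / sqrt (1 - t ^ 4) * indicator {0..x} t"
      using ae by eventually_elim (use sums in \<open>auto simp: sums_iff\<close>)
  qed (simp_all add: f_def)
  moreover have "arcsl x = (\<integral>t. 1 / sqrt (1 - t ^ 4) * indicator {0..x} t \<partial>lborel)"
    unfolding arcsl_def interval_integral_Icc[OF x(1)] set_lebesgue_integral_def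
    by (simp add: mult.commute)
  ultimately have "(\<lambda>k. x * (arcsl_coeff k * (x ^ 4) ^ k)) sums arcsl x" by (simp add: val)
  then show ?thesis
    using x summable_power_term[OF summable_arcsl_coeff less_imp_le[OF arcsl_coeff_pos], of "x ^ 4"]
    by (simp add: sums_iff power_le_one suminf_mult)
qed

lemma lerch_phi_eq_series: "lerch_phi z (3/2) (1/4) = (\<Sum>k. lerch_coeff k * z ^ k)"
  by (simp add: lerch_phi_def lerch_coeff_def)

section \<open>Numerical bounds at the endpoint\<close>

text \<open>The tail of the series from index \<open>k\<close> on is \<open>inv_sqrt_coeff k * R k\<close> with
\<open>R k = 1/2 + 1/(8k) + 1/(160 k\<^sup>2) + \<dots>\<close>, as matching powers of \<open>1/k\<close> in the recursion for
\<open>R\<close> shows. Truncating after \<open>1/(8k)\<close> gives a lower bound; enlarging the second-order term, to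
\<open>1/2 + 2/(16k - 1) = 1/2 + 1/(8k) + 1/(128 k\<^sup>2) + \<dots>\<close>, gives an upper bound. Both are rational
functions, so the telescoping conditions are polynomial inequalities.\<close>

lemma arcsl_coeff_sum_bounds:
  "1.311025 \<le> suminf arcsl_coeff" "suminf arcsl_coeff \<le> 1.311031"
proof -
  define G where "G k = inv_sqrt_coeff k * (1/2 + 1 / (8 * real k))" for k
  define H where "H k = inv_sqrt_coeff k * (1/2 + 2 / (16 * real k - 1))" for k
  have lim: "G \<longlonglongrightarrow> 0" "H \<longlonglongrightarrow> 0"
  proof -
    have "(\<lambda>k. 1/2 + 1 / (8 * real k)) \<longlonglongrightarrow> 1/2" "(\<lambda>k. 1/2 + 2 / (16 * real k - 1)) \<longlonglongrightarrow> 1/2"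
      by real_asymp+
    from this[THEN tendsto_mult[OF inv_sqrt_coeff_tendsto_0]] show "G \<longlonglongrightarrow> 0" "H \<longlonglongrightarrow> 0"
      by (simp_all add: G_def[abs_def] H_def[abs_def])
  qed
  \<comment> \<open>Shifting the variable to \<open>t = k - 16\<close> leaves polynomials with coefficients of one sign.\<close>
  have lo: "G k - G (Suc k) \<le> arcsl_coeff k" if "16 \<le> k" for k
  proof -
    define t where "t = real k - 16"
    have t: "real k = t + 16" "0 \<le> t" using that by (auto simp: t_def)
    have "(1/2 + 1 / (8 * real k)) - (2 * real k + 1) / (2 * real k + 2) * (1/2 + 1 / (8 * (real k + 1)))
        \<le> 1 / (4 * real k + 1)"
      using t(2) unfolding t(1) by (simp add: divide_simps) (simp add: algebra_simps)
    from mult_left_mono[OF this less_imp_le[OF inv_sqrt_coeff_pos[of k]]] show ?thesis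
      by (simp add: G_def arcsl_coeff_def inv_sqrt_coeff_Suc right_diff_distrib mult.assoc add.commute)
  qed
  have hi: "arcsl_coeff k \<le> H k - H (Suc k)" if "16 \<le> k" for k
  proof -
    define t where "t = real k - 16"
    have t: "real k = t + 16" "0 \<le> t" using that by (auto simp: t_def)
    have "1 / (4 * real k + 1) \<le>
        (1/2 + 2 / (16 * real k - 1)) - (2 * real k + 1) / (2 * real k + 2) * (1/2 + 2 / (16 * (real k + 1) - 1))"
      using t(2) unfolding t(1) by (simp add: divide_simps) (simp add: algebra_simps)
    from mult_left_mono[OF this less_imp_le[OF inv_sqrt_coeff_pos[of k]]] show ?thesis
      by (simp add: H_def arcsl_coeff_def inv_sqrt_coeff_Suc right_diff_distrib mult.assoc add.commute)
  qed
  have "1.311025 \<le> (\<Sum>k<16. arcsl_coeff k) + G 16" "(\<Sum>k<16. arcsl_coeff k) + H 16 \<le> 1.311031"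
    by (simp_all add: eval_nat_numeral arcsl_coeff_def G_def H_def inv_sqrt_coeff_Suc inv_sqrt_coeff_0)
  moreover have "(\<Sum>k<16. arcsl_coeff k) + G 16 \<le> suminf arcsl_coeff"
    "suminf arcsl_coeff \<le> (\<Sum>k<16. arcsl_coeff k) + H 16"
    by (rule suminf_ge_telescoping_tail[OF summable_arcsl_coeff lim(1) lo]
        suminf_le_telescoping_tail[OF summable_arcsl_coeff lim(2) hi]; assumption)+
  ultimately show "1.311025 \<le> suminf arcsl_coeff" "suminf arcsl_coeff \<le> 1.311031"
    by linarith+
qed

text \<open>Since \<open>lerch_coeff k\<^sup>2 = 64 / (4k + 1)\<^sup>3\<close>, decimal bounds for a coefficient are inequalities between
natural numbers.\<close>

lemma lerch_coeff_bounds: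
  fixes n k :: nat
  shows "n ^ 2 * (4 * k + 1) ^ 3 \<le> 64 * 10 ^ 14 \<Longrightarrow> real n / 10 ^ 7 \<le> lerch_coeff k"
    and "64 * 10 ^ 14 \<le> n ^ 2 * (4 * k + 1) ^ 3 \<Longrightarrow> lerch_coeff k \<le> real n / 10 ^ 7"
proof -
  have sq: "lerch_coeff k ^ 2 = 64 / (4 * real k + 1) ^ 3"
  proof -
    have "lerch_coeff k ^ 2 = 1 / (real k + 1/4) ^ 3"
      by (simp add: lerch_coeff_sqrt power_divide power_mult_distrib power3_eq_cube power2_eq_square)
    also have "real k + 1/4 = (4 * real k + 1) / 4" by simp
    also have "1 / \<dots> ^ 3 = 64 / (4 * real k + 1) ^ 3" by (simp add: power_divide)
    finally show ?thesis .
  qed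
  have pos: "0 < (4 * real k + 1) ^ 3" by (simp add: add_nonneg_pos)
  {
    assume "n ^ 2 * (4 * k + 1) ^ 3 \<le> 64 * 10 ^ 14"
    then have "real (n ^ 2 * (4 * k + 1) ^ 3) \<le> real (64 * 10 ^ 14)" by (rule of_nat_mono)
    then have "(real n / 10 ^ 7) ^ 2 \<le> lerch_coeff k ^ 2"
      using pos by (simp add: sq power_divide field_simps)
    then show "real n / 10 ^ 7 \<le> lerch_coeff k"
      by (rule power2_le_imp_le) (rule less_imp_le[OF lerch_coeff_pos])
  next
    assume "64 * 10 ^ 14 \<le> n ^ 2 * (4 * k + 1) ^ 3"
    then have "real (64 * 10 ^ 14) \<le> real (n ^ 2 * (4 * k + 1) ^ 3)" by (rule of_nat_mono)
    then have "lerch_coeff k ^ 2 \<le> (real n / 10 ^ 7) ^ 2"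
      using pos by (simp add: sq power_divide field_simps)
    then show "lerch_coeff k \<le> real n / 10 ^ 7" by (rule power2_le_imp_le) simp
  }
qed

lemma lerch_coeff_partial_sum_bounds:
  "9.7091656 \<le> (\<Sum>k<16. lerch_coeff k)" "(\<Sum>k<16. lerch_coeff k) \<le> 9.7091672"
proof -
  \<comment> \<open>The coefficients in units of \<open>10\<^sup>-\<^sup>7\<close>, rounded down.\<close>
  define ns :: "nat list" where
    "ns = [80000000, 7155417, 2962962, 1706769, 1141344, 831306, 640000, 512263,
           422006, 355457, 304729, 265015, 233236, 207336, 185899, 167917]"
  have "\<forall>k\<in>{..<16}. (ns ! k) ^ 2 * (4 * k + 1) ^ 3 \<le> 64 * 10 ^ 14"
    "\<forall>k\<in>{..<16}. 64 * 10 ^ 14 \<le> (ns ! k + 1) ^ 2 * (4 * k + 1) ^ 3"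
    by (simp_all add: ns_def lessThan_nat_numeral)
  note terms = this
  have "(\<Sum>k<16. real (ns ! k) / 10 ^ 7) \<le> (\<Sum>k<16. lerch_coeff k)"
    using terms(1) by (intro sum_mono lerch_coeff_bounds(1)) (rule bspec)
  moreover have "(\<Sum>k<16. lerch_coeff k) \<le> (\<Sum>k<16. real (ns ! k + 1) / 10 ^ 7)"
    using terms(2) by (intro sum_mono lerch_coeff_bounds(2)) (rule bspec)
  moreover have "(\<Sum>k<16. real (ns ! k) / 10 ^ 7) = 9.7091656"
     "(\<Sum>k<16. real (ns ! k + 1) / 10 ^ 7) = 9.7091672"
    by (simp_all add: ns_def lessThan_nat_numeral)
  ultimately show "9.7091656 \<le> (\<Sum>k<16. lerch_coeff k)" "(\<Sum>k<16. lerch_coeff k) \<le> 9.7091672"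
    by simp_all
qed

text \<open>The right-hand side is the integral of the convex function \<open>(t + 1/4) powr (-3/2)\<close> over
\<open>[k - 1/2, k + 1/2]\<close>, so this is the midpoint rule. With the square roots \<open>p\<close>, \<open>q\<close>, \<open>s\<close> of the
endpoints and the midpoint it reads \<open>p q (p + q) \<le> 2 s\<^sup>3\<close>, which follows from
\<open>p\<^sup>2 + q\<^sup>2 = 2 s\<^sup>2\<close>.\<close>

lemma lerch_coeff_le_midpoint:
  assumes "1 \<le> k"
  shows "lerch_coeff k \<le> 2 / sqrt (real k - 1/4) - 2 / sqrt (real (Suc k) - 1/4)"
proof -
  define p q s where "p = sqrt (real k - 1/4)" "q = sqrt (real (Suc k) - 1/4)" "s = sqrt (real k + 1/4)"
  have k: "1 \<le> real k" using assms by simp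
  have pos: "0 < p" "0 < q" "0 < s" using k by (auto simp: p_q_s_def)
  have sq: "p\<^sup>2 = real k - 1/4" "q\<^sup>2 = real k + 3/4" "s\<^sup>2 = real k + 1/4"
    using k by (auto simp: p_q_s_def)
  have pq: "p * q \<le> s\<^sup>2"
    using sum_squares_bound[of p q] sq by simp
  have "(p + q)\<^sup>2 \<le> (2 * s)\<^sup>2"
    using pq sq by (simp add: power2_sum power_mult_distrib)
  then have "p + q \<le> 2 * s" by (rule power2_le_imp_le) (use pos in simp)
  then have "(p * q) * (p + q) \<le> s\<^sup>2 * (2 * s)" using pq pos by (intro mult_mono) auto
  then have "2 / (s\<^sup>2 * (2 * s)) \<le> 2 / ((p * q) * (p + q))" using pos by (intro divide_left_mono) auto
  also have "\<dots> = 2 / p - 2 / q"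
  proof -
    have "(q - p) * (p + q) = 1" using sq by (simp add: algebra_simps power2_eq_square)
    then have "2 / ((p * q) * (p + q)) = 2 * ((q - p) * (p + q)) / ((p * q) * (p + q))" by simp
    also have "\<dots> = 2 / p - 2 / q" using pos by (simp add: divide_simps) 
    finally show ?thesis .
  qed
  finally show ?thesis using pos sq(3) by (simp add: lerch_coeff_sqrt p_q_s_def)
qed

text \<open>The trapezoidal rule for the same convex function, now over \<open>[k, k + 1]\<close>. It reduces to
\<open>4 p\<^sup>2 q\<^sup>2 \<le> (p + q) (p\<^sup>3 + q\<^sup>3)\<close>, where the difference of the two sides is
\<open>(p\<^sup>2 - q\<^sup>2)\<^sup>2 + p q (p - q)\<^sup>2\<close>.\<close>

lemma lerch_coeff_ge_trapezoid:
  fixes G :: "nat \<Rightarrow> real"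
  defines "G \<equiv> \<lambda>k. 2 / sqrt (real k + 1/4) + lerch_coeff k / 2"
  shows "G k - G (Suc k) \<le> lerch_coeff k"
proof -
  define p q where "p = sqrt (real k + 1/4)" "q = sqrt (real (Suc k) + 1/4)"
  have pos: "0 < p" "0 < q" by (auto simp: p_q_def)
  have sq: "p\<^sup>2 = real k + 1/4" "q\<^sup>2 = real (Suc k) + 1/4"
    by (auto simp: p_q_def)
  have "lerch_coeff k = 1 / (p\<^sup>2 * p)" "lerch_coeff (Suc k) = 1 / (q\<^sup>2 * q)"
    unfolding lerch_coeff_sqrt sq by (simp_all only: p_q_def)
  then have co: "lerch_coeff k = 1 / p ^ 3" "lerch_coeff (Suc k) = 1 / q ^ 3"
    by (simp_all add: power2_eq_square power3_eq_cube)
  have one: "(q - p) * (p + q) = 1" using sq by (simp add: algebra_simps power2_eq_square)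
  have "0 \<le> (p\<^sup>2 - q\<^sup>2)\<^sup>2 + p * q * (p - q)\<^sup>2" using pos by simp
  then have "4 * p\<^sup>2 * q\<^sup>2 \<le> (p + q) * (p ^ 3 + q ^ 3)"
    by (simp add: algebra_simps power2_eq_square power3_eq_cube)
  moreover have "0 \<le> q - p" by (simp add: p_q_def)
  ultimately have "(q - p) * (4 * p\<^sup>2 * q\<^sup>2) \<le> (q - p) * ((p + q) * (p ^ 3 + q ^ 3))"
    by (rule mult_left_mono)
  also have "\<dots> = p ^ 3 + q ^ 3" by (simp only: one mult_1_left flip: mult.assoc)
  finally have "(q - p) * (4 * p\<^sup>2 * q\<^sup>2) \<le> p ^ 3 + q ^ 3" .
  then have "(q - p) * (4 * p\<^sup>2 * q\<^sup>2) / (2 * p ^ 3 * q ^ 3) \<le> (p ^ 3 + q ^ 3) / (2 * p ^ 3 * q ^ 3)"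
    using pos by (intro divide_right_mono) auto
  moreover have "(q - p) * (4 * p\<^sup>2 * q\<^sup>2) / (2 * p ^ 3 * q ^ 3) = 2 / p - 2 / q"
    using pos by (simp add: field_simps power2_eq_square power3_eq_cube)
  moreover have "(p ^ 3 + q ^ 3) / (2 * p ^ 3 * q ^ 3) = (1 / p ^ 3 + 1 / q ^ 3) / 2"
    using pos by (simp add: field_simps)
  ultimately have gap: "2 / p - 2 / q \<le> (1 / p ^ 3 + 1 / q ^ 3) / 2" by simp
  have regroup: "a - b \<le> (u + v) / 2 \<Longrightarrow> a + u / 2 - (b + v / 2) \<le> u" for a b u v :: real
    by (simp add: field_simps)
  show ?thesis
    unfolding G_def co p_q_def[symmetric] by (rule regroup[OF gap])
qed

lemma lerch_coeff_sum_bounds: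
  "10.21292 \<le> suminf lerch_coeff" "suminf lerch_coeff \<le> 10.2132"
proof -
  have "(\<lambda>k. 2 / sqrt (real k - 1/4)) \<longlonglongrightarrow> 0" by real_asymp
  from suminf_le_telescoping_tail[OF summable_lerch_coeff this, of 16]
  have "suminf lerch_coeff \<le> (\<Sum>k<16. lerch_coeff k) + 2 / sqrt (16 - 1/4)"
    using lerch_coeff_le_midpoint by simp
  moreover have "2 / sqrt (16 - 1/4) \<le> (0.50396::real)"
  proof -
    have "3.96857 \<le> sqrt (16 - 1/4::real)" by (rule real_le_rsqrt) (simp add: power2_eq_square)
    then have "2 / sqrt (16 - 1/4) \<le> (2 / 3.96857::real)" by (intro divide_left_mono) auto
    then show ?thesis by simp
  qed
  ultimately show "suminf lerch_coeff \<le> 10.2132"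
    using lerch_coeff_partial_sum_bounds(2) by simp
  have "(\<lambda>k. 2 / sqrt (real k + 1/4)) \<longlonglongrightarrow> 0" by real_asymp
  moreover have "(\<lambda>k. lerch_coeff k / 2) \<longlonglongrightarrow> 0"
    using tendsto_divide[OF summable_LIMSEQ_zero[OF summable_lerch_coeff] tendsto_const, of 2] by simp
  ultimately have "(\<lambda>k. 2 / sqrt (real k + 1/4) + lerch_coeff k / 2) \<longlonglongrightarrow> 0"
    using tendsto_add by fastforce
  from suminf_ge_telescoping_tail[OF summable_lerch_coeff this lerch_coeff_ge_trapezoid, of 16]
  have "(\<Sum>k<16. lerch_coeff k) + (2 / sqrt (16 + 1/4) + lerch_coeff 16 / 2) \<le> suminf lerch_coeff"
    by simp
  moreover have "0.496138 \<le> 2 / sqrt (16 + 1/4::real)"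
  proof -
    have "sqrt (16 + 1/4::real) \<le> 4.03113" by (rule real_le_lsqrt) (simp_all add: power2_eq_square)
    then have "2 / 4.03113 \<le> (2 / sqrt (16 + 1/4)::real)" by (intro divide_left_mono) auto
    then show ?thesis by simp
  qed
  moreover have "0.01526 \<le> lerch_coeff 16"
    using lerch_coeff_bounds(1)[of 152600 16] by simp
  ultimately show "10.21292 \<le> suminf lerch_coeff"
    using lerch_coeff_partial_sum_bounds(1) by simp
qed

section \<open>Sharp bounds for the arc lemniscate sine\<close>

theorem mainTheorem1:
  fixes \<alpha> \<beta> :: real
  assumes alpha: "\<alpha> = 1 / 8"
    and beta: "\<beta> = arcsl 1 / lerch_phi 1 (3/2) (1/4)"
  shows "(\<forall>x\<in>{0<..<1::real}.
            \<alpha> * x * lerch_phi (x ^ 4) (3/2) (1/4) < arcsl x \<and>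
            arcsl x < \<beta> * x * lerch_phi (x ^ 4) (3/2) (1/4)) \<and>
         (\<forall>c::real. (\<forall>x\<in>{0<..<1::real}. c * x * lerch_phi (x ^ 4) (3/2) (1/4) < arcsl x)
            \<longrightarrow> c \<le> \<alpha>) \<and>
         (\<forall>c::real. (\<forall>x\<in>{0<..<1::real}. arcsl x < c * x * lerch_phi (x ^ 4) (3/2) (1/4))
            \<longrightarrow> \<beta> \<le> c) \<and>
         0.12836 \<le> \<beta> \<and> \<beta> < 0.12837"
proof -
  define A B where "A z = (\<Sum>k. arcsl_coeff k * z ^ k)" and "B z = (\<Sum>k. lerch_coeff k * z ^ k)" for z
  note sa = summable_arcsl_coeff and sb = summable_lerch_coeff
  note an = less_imp_le[OF arcsl_coeff_pos] and bn = less_imp_le[OF lerch_coeff_pos]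
  have arcsl: "arcsl x = x * A (x ^ 4)" if "0 \<le> x" "x \<le> 1" for x
    using arcsl_eq_series[OF that] by (simp add: A_def)
  have lerch: "lerch_phi z (3/2) (1/4) = B z" for z
    by (simp add: lerch_phi_eq_series B_def)
  have ends: "A 1 = suminf arcsl_coeff" "B 1 = suminf lerch_coeff" by (simp_all add: A_def B_def)
  have beta': "\<beta> = A 1 / B 1" using arcsl[of 1] by (simp add: beta lerch)
  have B1: "0 < B 1" using lerch_coeff_sum_bounds by (simp add: ends)
  have first: "arcsl_coeff 0 / lerch_coeff 0 = \<alpha>"
    by (simp add: coeff_ratio inv_sqrt_coeff_0 real_sqrt_divide alpha)
  have zero: "A 0 = 1" "B 0 = 8"
  proof -
    have "lerch_coeff 0 = 8" by (simp add: lerch_coeff_sqrt real_sqrt_divide)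
    then show "A 0 = 1" "B 0 = 8"
      using powser_zero[of arcsl_coeff] powser_zero[of lerch_coeff]
      by (simp_all add: A_def B_def arcsl_coeff_def inv_sqrt_coeff_0)
  qed
  have cA: "continuous_on {0..1} (\<lambda>x. A (x ^ 4))" and cB: "continuous_on {0..1} (\<lambda>x. B (x ^ 4))"
    unfolding A_def B_def
    by (rule continuous_on_compose2[OF continuous_on_power_series_closed[OF sa an]]
        continuous_on_compose2[OF continuous_on_power_series_closed[OF sb bn]];
        auto intro!: continuous_intros power_le_one)+
  have strict: "\<alpha> * x * B (x ^ 4) < arcsl x \<and> arcsl x < \<beta> * x * B (x ^ 4)" if x: "x \<in> {0<..<1}" for x
  proof -
    have z: "0 < x ^ 4" "x ^ 4 < 1" using x by (auto simp: power_less_one_iff)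
    have "\<alpha> * B (x ^ 4) < A (x ^ 4)"
      using power_series_gt_first_ratio[OF sa sb an lerch_coeff_pos coeff_ratio_strict_mono, of "x ^ 4"] z
      by (simp add: first A_def B_def)
    moreover have "A (x ^ 4) < \<beta> * B (x ^ 4)"
      using power_series_lt_endpoint_ratio[OF sa sb an lerch_coeff_pos coeff_ratio_strict_mono, of "x ^ 4"] z
      by (simp add: beta' ends) (simp add: A_def B_def)
    ultimately show ?thesis using x arcsl[of x] by (simp add: mult.assoc mult.left_commute[of _ x])
  qed
  \<comment> \<open>Dividing by \<open>x\<close> leaves inequalities between continuous functions on \<open>[0, 1]\<close>, so they
    persist at the endpoints: \<open>0\<close> bounds the constant on the left, \<open>1\<close> the one on the right.\<close>
  have closure: "closure {0<..<1::real} = {0..1}" by simp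
  have best_alpha: "c \<le> \<alpha>" if c: "\<forall>x\<in>{0<..<1}. c * x * B (x ^ 4) < arcsl x" for c
  proof -
    have "0 \<le> A (0 ^ 4) - c * B (0 ^ 4)"
    proof (rule continuous_ge_on_closure[where S = "{0<..<1::real}" and f = "\<lambda>x. A (x ^ 4) - c * B (x ^ 4)"])
      show "continuous_on (closure {0<..<1}) (\<lambda>x. A (x ^ 4) - c * B (x ^ 4))"
        unfolding closure using cA cB by (intro continuous_intros)
      show "0 \<le> A (x ^ 4) - c * B (x ^ 4)" if "x \<in> {0<..<1}" for x
        using bspec[OF c that] that arcsl[of x] by (simp add: mult.assoc mult.left_commute[of _ x])
    qed simp
    then show ?thesis by (simp add: zero alpha)
  qed
  have best_beta: "\<beta> \<le> c" if c: "\<forall>x\<in>{0<..<1}. arcsl x < c * x * B (x ^ 4)" for c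
  proof -
    have "0 \<le> c * B (1 ^ 4) - A (1 ^ 4)"
    proof (rule continuous_ge_on_closure[where S = "{0<..<1::real}" and f = "\<lambda>x. c * B (x ^ 4) - A (x ^ 4)"])
      show "continuous_on (closure {0<..<1}) (\<lambda>x. c * B (x ^ 4) - A (x ^ 4))"
        unfolding closure using cA cB by (intro continuous_intros)
      show "0 \<le> c * B (x ^ 4) - A (x ^ 4)" if "x \<in> {0<..<1}" for x
        using bspec[OF c that] that arcsl[of x] by (simp add: mult.assoc mult.left_commute[of _ x])
    qed simp
    then show ?thesis using B1 by (simp add: beta' field_simps)
  qed
  have "0.12836 \<le> \<beta>" "\<beta> < 0.12837"
    using arcsl_coeff_sum_bounds lerch_coeff_sum_bounds B1 by (simp_all add: beta' field_simps ends)
  then show ?thesis using strict best_alpha best_beta by (simp add: lerch)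
qed

end
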